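(* Let $A$ and $B$ be uniform algebras on compact Hausdorff spaces $X$ and $Y$ respectively. Let $a,b\in\mathbb{C}$ and let $p(z,w)=zw+az+bw+ab$. Suppose that $T$ is a map (not assumed to be linear, multiplicative or continuous) from $A$ onto $B$ such that the equality \[ \mathrm{Ran}_{\pi}(p(Tf,Tg))=\mathrm{Ran}_{\pi}(p(f,g)) \] holds for every pair $f$ and $g$ in $A$. Then the following hold. (1) If $a\neq b$, then $T$ is an algebra isomorphism from $A$ onto $B$. Thus there exists a homeomorphism $\Phi$ from $M_B$ onto $M_A$ such that \[ \widehat{Tf}(y)=\hat f(\Phi(y)),\quad y\in M_B, \] holds for every $f\in A$. (2) If $a=b$, then there exist a continuous map $\eta:M_B\to\{-1,1\}$ and a homeomorphism $\Phi$ from $M_B$ onto $M_A$ such that the equality \[ \widehat{Tf}(y)=\eta(y)\hat f(\Phi(y))+a(\eta(y)-1),\quad y\in M_B, \] holds for every $f\in A$.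
   Context: For a compact Hausdorff space $X$, $C(X)$ is the algebra of all complex-valued continuous functions on $X$. A uniform algebra on $X$ is a uniformly closed subalgebra of $C(X)$ which separates the points of $X$ and contains the constant functions. For $f$ in a uniform algebra on $X$, the peripheral range of $f$ is $\mathrm{Ran}_{\pi}(f)=\{z\in f(X): |z|=\|f\|_{\infty(X)}\}$, where $\|\cdot\|_{\infty(X)}$ is the supremum norm on $X$ (and similarly for uniform algebras on $Y$). For $f,g\in A$, $p(f,g)$ denotes $fg+af+bg+ab\cdot 1\in A$, and similarly in $B$. For a commutative Banach algebra $\mathcal{A}$, $M_{\mathcal{A}}$ denotes its maximal ideal space (with the Gelfand topology) and $\hat f$ denotes the Gelfand transform of $f\in\mathcal{A}$. *)

theory Defs
  imports "HOL-Analysis.Analysis"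
begin

definition uniform_algebra :: "('x::topological_space \<Rightarrow> complex) set \<Rightarrow> bool" where
  "uniform_algebra A \<longleftrightarrow>
     (\<forall>f\<in>A. continuous_on UNIV f) \<and>
     (\<forall>f\<in>A. \<forall>g\<in>A. (\<lambda>x. f x + g x) \<in> A) \<and>
     (\<forall>f\<in>A. \<forall>g\<in>A. (\<lambda>x. f x * g x) \<in> A) \<and>
     (\<forall>c. \<forall>f\<in>A. (\<lambda>x. c * f x) \<in> A) \<and>
     (\<forall>F g. (\<forall>n. F n \<in> A) \<and> uniform_limit UNIV F g sequentially \<longrightarrow> g \<in> A) \<and>
     (\<forall>x y. x \<noteq> y \<longrightarrow> (\<exists>f\<in>A. f x \<noteq> f y)) \<and>
     (\<forall>c. (\<lambda>x. c) \<in> A)"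

definition sup_norm :: "('x \<Rightarrow> complex) \<Rightarrow> real" where
  "sup_norm f = (SUP x. cmod (f x))"

definition peripheral_range :: "('x \<Rightarrow> complex) \<Rightarrow> complex set" where
  "peripheral_range f = {z \<in> range f. cmod z = sup_norm f}"

definition p_poly :: "complex \<Rightarrow> complex \<Rightarrow> ('x \<Rightarrow> complex) \<Rightarrow> ('x \<Rightarrow> complex) \<Rightarrow> 'x \<Rightarrow> complex" where
  "p_poly a b f g = (\<lambda>x. f x * g x + a * f x + b * g x + a * b)"

definition algebra_isomorphism ::
  "('x \<Rightarrow> complex) set \<Rightarrow> ('y \<Rightarrow> complex) set \<Rightarrow> (('x \<Rightarrow> complex) \<Rightarrow> 'y \<Rightarrow> complex) \<Rightarrow> bool" where
  "algebra_isomorphism A B T \<longleftrightarrow>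
     bij_betw T A B \<and>
     (\<forall>f\<in>A. \<forall>g\<in>A. T (\<lambda>x. f x + g x) = (\<lambda>y. T f y + T g y)) \<and>
     (\<forall>c. \<forall>f\<in>A. T (\<lambda>x. c * f x) = (\<lambda>y. c * T f y)) \<and>
     (\<forall>f\<in>A. \<forall>g\<in>A. T (\<lambda>x. f x * g x) = (\<lambda>y. T f y * T g y))"

text \<open>Maximal ideals are identified, as usual, with the nonzero multiplicative linear functionals
  on the algebra. Functionals are taken to be \<^const>\<open>undefined\<close> outside \<open>A\<close>, so that
  functionals agreeing on \<open>A\<close> are equal.\<close>

definition characters :: "('x \<Rightarrow> complex) set \<Rightarrow> (('x \<Rightarrow> complex) \<Rightarrow> complex) set" where
  "characters A = {\<phi> \<in> extensional A.
     (\<forall>f\<in>A. \<forall>g\<in>A. \<phi> (\<lambda>x. f x + g x) = \<phi> f + \<phi> g) \<and>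
     (\<forall>c. \<forall>f\<in>A. \<phi> (\<lambda>x. c * f x) = c * \<phi> f) \<and>
     (\<forall>f\<in>A. \<forall>g\<in>A. \<phi> (\<lambda>x. f x * g x) = \<phi> f * \<phi> g) \<and>
     (\<exists>f\<in>A. \<phi> f \<noteq> 0)}"

text \<open>The Gelfand topology is the topology of pointwise convergence on \<open>A\<close>.\<close>

definition maximal_ideal_space ::
  "('x \<Rightarrow> complex) set \<Rightarrow> (('x \<Rightarrow> complex) \<Rightarrow> complex) topology" where
  "maximal_ideal_space A =
     subtopology (product_topology (\<lambda>f. euclidean) A) (characters A)"

definition gelfand :: "('x \<Rightarrow> complex) \<Rightarrow> (('x \<Rightarrow> complex) \<Rightarrow> complex) \<Rightarrow> complex" where
  "gelfand f \<phi> = \<phi> f"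

end

theory Submission
  imports Defs
begin

text \<open>Since \<open>p(z, w) = (z + b) (w + a)\<close>, the hypothesis says that \<open>(Tf + b) (Tg + a)\<close> and
  \<open>(f + b) (g + a)\<close> have the same peripheral range. Say that \<open>x\<close> is a strong boundary point if it is
  the only common peak point of the peaking functions \<open>h\<close> (at each point \<open>h = 1\<close> or
  \<open>|h| < 1\<close>) with \<open>h x = 1\<close>. By Bishop's construction and Zorn's lemma these
  points determine the functions of a uniform algebra. Transporting peaking functions through the
  hypothesis in both directions matches the strong boundary points of \<open>B\<close> with those of \<open>A\<close>; at matched
  points \<open>Tf(y) + b = u(y) (f(x) + b)\<close> and \<open>Tg(y) + a = v(y) (g(x) + a)\<close> with
  \<open>u = T(1 - b) + b\<close>, \<open>v = T(1 - a) + a\<close> and \<open>u v = 1\<close>. If \<open>a = b\<close> then \<open>u = v\<close>; otherwise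
  \<open>f = -b\<close> yields \<open>u = v = 1\<close>. So \<open>f \<mapsto> u (Tf + b) - b\<close> is an algebra isomorphism, and composition
  with it is the homeomorphism of the maximal ideal spaces.\<close>

section \<open>A numerical estimate for binary weighted series\<close>

text \<open>Used pointwise in Bishop's construction, with \<open>c m\<close> the value of the m-th
  factor and \<open>s\<close> equal to |h(x)| - 1, or to 0 for the plain bound. Terms whose weight
  exceeds \<open>s\<close> are bounded only by 1, but they force \<open>s\<close> to be small; the
  remaining terms are small themselves.\<close>

lemma norm_binary_series_le:
  fixes c :: "nat \<Rightarrow> complex" and s M :: real
  assumes c: "\<And>m. cmod (c m) \<le> 1"
    and small: "\<And>m. (1/2) ^ Suc m \<le> s \<Longrightarrow> cmod (c m) \<le> (1/2) ^ Suc m \<and> cmod (c m) \<le> 1 / (1 + M)"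
    and s: "s \<le> M" "0 \<le> 1 + s" "0 \<le> M"
  shows "(1 + s) * cmod (\<Sum>m. (1/2) ^ Suc m * c m) \<le> 1"
proof -
  let ?w = "\<lambda>m::nat. (1/2 :: real) ^ Suc m"
  let ?S = "\<Sum>m. (1/2) ^ Suc m * c m"
  have bound: "cmod ?S \<le> D" if d: "\<And>m. cmod (c m) \<le> d m" "(\<lambda>m. ?w m * d m) sums D" for d D
  proof -
    have "cmod ?S \<le> (\<Sum>m. ?w m * d m)"
      by (rule norm_suminf_le)
         (use d in \<open>auto simp: norm_mult norm_power norm_divide sums_iff intro!: mult_left_mono\<close>)
    then show ?thesis using d(2) by (simp add: sums_iff)
  qed
  show ?thesis
  proof (cases "s \<le> 0")
    case True
    have "cmod ?S \<le> 1"
      by (rule bound[where d = "\<lambda>_. 1"]) (use c power_half_series in auto)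
    with True s show ?thesis by (intro mult_le_one) auto
  next
    case False
    then obtain n where "(1/2) ^ n < s" using real_arch_pow_inv[of s "1/2"] by auto
    moreover have "?w n \<le> (1/2) ^ n" by simp
    ultimately have ex: "\<exists>n. ?w n \<le> s" by (intro exI[of _ n]) linarith
    \<comment> \<open>From the first index with weight at most \<open>s\<close> on, the smallness
      hypothesis applies, because the weights decrease.\<close>
    define N where "N = (LEAST n. ?w n \<le> s)"
    have N: "?w N \<le> s" unfolding N_def using ex by (rule LeastI_ex)
    have Nmin: "s < ?w m" if "m < N" for m
      using not_less_Least[of m "\<lambda>n. ?w n \<le> s"] that unfolding N_def by auto
    have wN: "?w m \<le> ?w N" if "N \<le> m" for m
      by (rule power_decreasing) (use that in auto)
    show ?thesis
    proof (cases N)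
      \<comment> \<open>Here \<open>s\<close> may be large, but every term is small, and the bound
        1/(1 + M) absorbs the factor 1 + s.\<close>
      case 0
      have "cmod ?S \<le> 1 / (1 + M)"
      proof (rule bound)
        show "cmod (c m) \<le> 1 / (1 + M)" for m
          using small[of m] wN[of m] N 0 by auto
        show "(\<lambda>m. ?w m * (1 / (1 + M))) sums (1 / (1 + M))"
          using sums_mult2[OF power_half_series, of "1 / (1 + M)"] by simp
      qed
      then have "(1 + s) * cmod ?S \<le> (1 + M) * (1 / (1 + M))"
        using s by (intro mult_mono) auto
      then show ?thesis using s by simp
    next
      case (Suc k)
      \<comment> \<open>The weight at index N - 1 is q, hence s < q, while the weight at index N is
        q/2.\<close>
      define q where "q = (1/2::real) ^ N"
      have q: "0 < q" "q \<le> 1" by (auto simp: q_def power_le_one)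
      have sq: "s < q" using Nmin[of k] Suc by (simp add: q_def)
      have "sum ?w {..<n} = 1 - (1/2) ^ n" for n by (induction n) auto
      then have sumw: "sum ?w {..<N} = 1 - q" by (simp add: q_def)
      define d where "d m = (if m < N then 1 else q / 2)" for m
      have "cmod ?S \<le> q / 2 + (1 - q / 2) * (1 - q)"
      proof (rule bound)
        show "cmod (c m) \<le> d m" for m
        proof (cases "m < N")
          case False
          then have "cmod (c m) \<le> ?w m" using False small[of m] order_trans[OF wN[of m] N] by simp
          also have "\<dots> \<le> q / 2" using wN[of m] False by (simp add: q_def)
          finally show ?thesis using False by (simp add: d_def)
        qed (simp add: d_def c)
        \<comment> \<open>The majorant \<open>d\<close> is split into the constant q/2 and the
          excess 1 - q/2 over the first N indices.\<close>
        have "(\<lambda>m. if m \<in> {..<N} then (1 - q / 2) * ?w m else 0) sums (\<Sum>m<N. (1 - q / 2) * ?w m)"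
          by (rule sums_If_finite_set) auto
        then have "(\<lambda>m. if m < N then (1 - q / 2) * ?w m else 0) sums ((1 - q / 2) * (1 - q))"
          by (simp only: sum_distrib_left[symmetric] sumw lessThan_iff)
        from sums_add[OF sums_mult2[OF power_half_series, of "q/2"] this]
        have "(\<lambda>m. ?w m * (q / 2) + (if m < N then (1 - q / 2) * ?w m else 0))
          sums (q / 2 + (1 - q / 2) * (1 - q))" by simp
        moreover have "?w m * (q / 2) + (if m < N then (1 - q / 2) * ?w m else 0) = ?w m * d m" for m
          by (simp add: d_def field_simps)
        ultimately show "(\<lambda>m. ?w m * d m) sums (q / 2 + (1 - q / 2) * (1 - q))"
          by (simp only:)
      qed
      also have "\<dots> = 1 - q + q\<^sup>2 / 2" by (simp add: field_simps power2_eq_square)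
      finally have "(1 + s) * cmod ?S \<le> (1 + q) * (1 - q + q\<^sup>2 / 2)"
        using sq q s by (intro mult_mono) auto
      also have "\<dots> = 1 - q\<^sup>2 * (1 - q) / 2"
        by (simp add: field_simps power2_eq_square)
      also have "\<dots> \<le> 1" using q by simp
      finally show ?thesis .
    qed
  qed
qed

section \<open>Peaking functions and elementary properties of uniform algebras\<close>

text \<open>The peak set may be empty; a point where the value 1 is attained is demanded separately
  wherever it matters.\<close>

definition peaking :: "('x \<Rightarrow> complex) set \<Rightarrow> ('x \<Rightarrow> complex) set" where
  "peaking A = {f \<in> A. \<forall>x. f x = 1 \<or> cmod (f x) < 1}"

text \<open>These are the weak peak points, which for a uniform algebra form the Choquet
  boundary.\<close>

definition strong_boundary :: "('x \<Rightarrow> complex) set \<Rightarrow> 'x set" where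
  "strong_boundary A = {x. \<forall>y. (\<forall>f\<in>peaking A. f x = 1 \<longrightarrow> f y = 1) \<longrightarrow> y = x}"

lemma peaking_norm_le: "f \<in> peaking A \<Longrightarrow> cmod (f x) \<le> 1"
  unfolding peaking_def by (auto dest!: spec[of _ x])

lemma peaking_eq_1: "f \<in> peaking A \<Longrightarrow> 1 \<le> cmod (f x) \<Longrightarrow> f x = 1"
  unfolding peaking_def by force

lemma peaking_norm_less: "f \<in> peaking A \<Longrightarrow> f x \<noteq> 1 \<Longrightarrow> cmod (f x) < 1"
  unfolding peaking_def by force

text \<open>Strict convexity of the disc: |1 + z| = 2 and |z| <= 1 force Re z = 1 and then Im z =
  0.\<close>

lemma norm_midpoint_1_less:
  fixes z :: complex
  assumes "cmod z \<le> 1" "z \<noteq> 1"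
  shows "cmod ((1 + z) / 2) < 1"
proof -
  have "cmod (1 + z) \<noteq> 2"
  proof
    assume "cmod (1 + z) = 2"
    then have "(1 + Re z)\<^sup>2 + (Im z)\<^sup>2 = 4"
      using cmod_power2[of "1 + z"] by simp
    moreover have "(Re z)\<^sup>2 + (Im z)\<^sup>2 \<le> 1"
      using assms(1) cmod_power2[of z] by (metis norm_ge_zero power_le_one)
    moreover have "Re z \<le> 1" using assms(1) complex_Re_le_cmod[of z] by linarith
    ultimately have "Re z = 1" by (simp add: power2_eq_square algebra_simps)
    with \<open>(Re z)\<^sup>2 + (Im z)\<^sup>2 \<le> 1\<close> have "z = 1" by (simp add: complex_eq_iff)
    with assms(2) show False by simp
  qed
  moreover have "cmod (1 + z) \<le> 2"
    using norm_triangle_ineq[of 1 z] assms(1) by simp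
  ultimately show ?thesis by (simp add: norm_divide)
qed

locale compact_uniform_algebra =
  fixes A :: "('x::t2_space \<Rightarrow> complex) set"
  assumes compact_UNIV: "compact (UNIV :: 'x set)"
    and uniform_algebra: "uniform_algebra A"
begin

lemma
  shows continuous: "f \<in> A \<Longrightarrow> continuous_on UNIV f"
    and add: "f \<in> A \<Longrightarrow> g \<in> A \<Longrightarrow> (\<lambda>x. f x + g x) \<in> A"
    and mult: "f \<in> A \<Longrightarrow> g \<in> A \<Longrightarrow> (\<lambda>x. f x * g x) \<in> A"
    and scale: "f \<in> A \<Longrightarrow> (\<lambda>x. c * f x) \<in> A"
    and const: "(\<lambda>x. c) \<in> A"
    and separates: "x \<noteq> y \<Longrightarrow> \<exists>f\<in>A. f x \<noteq> f y"
  using uniform_algebra unfolding uniform_algebra_def by simp_all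

lemma uniform_limit:
  assumes "\<And>n. F n \<in> A" "uniform_limit UNIV F g sequentially"
  shows "g \<in> A"
proof -
  have "\<forall>F g. (\<forall>n. F n \<in> A) \<and> uniform_limit UNIV F g sequentially \<longrightarrow> g \<in> A"
    using uniform_algebra unfolding uniform_algebra_def by (elim conjE)
  with assms show ?thesis by blast
qed

lemma diff: "f \<in> A \<Longrightarrow> g \<in> A \<Longrightarrow> (\<lambda>x. f x - g x) \<in> A"
  using add[of f "\<lambda>x. -1 * g x"] scale[of g "-1"] by simp

lemma divide: "f \<in> A \<Longrightarrow> (\<lambda>x. f x / c) \<in> A"
  using scale[of f "inverse c"] by (simp add: field_simps)

lemma sum_mem: "finite N \<Longrightarrow> (\<And>n. n \<in> N \<Longrightarrow> F n \<in> A) \<Longrightarrow> (\<lambda>x. \<Sum>n\<in>N. F n x) \<in> A"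
  by (induction N rule: finite_induct) (auto intro: const add)

lemma separating_function:
  assumes "x \<noteq> y"
  shows "\<exists>f\<in>A. f x = 0 \<and> f y = 1"
proof -
  obtain f where f: "f \<in> A" "f x \<noteq> f y" using separates[OF assms] by blast
  then show ?thesis
    by (intro bexI[of _ "\<lambda>z. (f z - f x) / (f y - f x)"] divide diff const) auto
qed

lemma bdd_above_norm: "f \<in> A \<Longrightarrow> bdd_above (range (\<lambda>x. cmod (f x)))"
  by (intro bounded_imp_bdd_above compact_imp_bounded compact_continuous_image compact_UNIV
      continuous_on_norm continuous)

lemma norm_le_sup_norm: "f \<in> A \<Longrightarrow> cmod (f x) \<le> sup_norm f"
  unfolding sup_norm_def by (rule cSUP_upper[OF UNIV_I bdd_above_norm])

lemma sup_norm_attained: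
  assumes "f \<in> A"
  shows "\<exists>x. cmod (f x) = sup_norm f"
proof -
  obtain x where "\<And>y. cmod (f y) \<le> cmod (f x)"
    using continuous_attains_sup[OF compact_UNIV, of "\<lambda>x. cmod (f x)"] continuous[OF assms]
    by (auto intro: continuous_intros)
  then have "sup_norm f \<le> cmod (f x)"
    unfolding sup_norm_def by (intro cSUP_least) auto
  with norm_le_sup_norm[OF assms] show ?thesis by (intro exI[of _ x]) (simp add: antisym)
qed

lemma sup_norm_le: "(\<And>x. cmod (f x) \<le> c) \<Longrightarrow> sup_norm f \<le> c"
  unfolding sup_norm_def by (intro cSUP_least) auto

lemma peripheral_range_nonempty: "f \<in> A \<Longrightarrow> peripheral_range f \<noteq> {}"
  using sup_norm_attained[of f] unfolding peripheral_range_def by blast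

lemma peaking_mem: "f \<in> peaking A \<Longrightarrow> f \<in> A"
  by (simp add: peaking_def)

lemma peaking_1: "(\<lambda>_. 1) \<in> peaking A"
  by (simp add: peaking_def const)

lemma peaking_mult:
  assumes "f \<in> peaking A" "g \<in> peaking A"
  shows "(\<lambda>x. f x * g x) \<in> peaking A"
proof -
  have "f x * g x = 1 \<or> cmod (f x * g x) < 1" for x
  proof (cases "f x = 1")
    case True
    then show ?thesis using assms(2) by (simp add: peaking_def)
  next
    case False
    have "cmod (f x) * cmod (g x) \<le> cmod (f x)"
      by (rule mult_left_le) (use peaking_norm_le[OF assms(2)] in auto)
    with peaking_norm_less[OF assms(1) False] show ?thesis by (simp add: norm_mult)
  qed
  then show ?thesis using assms by (simp add: peaking_def mult)
qed

lemma peaking_power: "f \<in> peaking A \<Longrightarrow> (\<lambda>x. f x ^ n) \<in> peaking A"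
  by (induction n) (auto intro: peaking_1 peaking_mult)

lemma peaking_midpoint:
  assumes "f \<in> A" "\<And>x. cmod (f x) \<le> 1"
  shows "(\<lambda>x. (1 + f x) / 2) \<in> peaking A"
proof -
  have "(1 + f x) / 2 = 1 \<or> cmod ((1 + f x) / 2) < 1" for x
    using norm_midpoint_1_less[OF assms(2)[of x]] by (cases "f x = 1") auto
  then show ?thesis
    unfolding peaking_def using divide[OF add[OF const assms(1)]] by blast
qed

text \<open>Unlike the midpoint alone, this product keeps \<open>f\<close> as a factor, which
  \<open>bishop_peaking\<close> exploits.\<close>

lemma peaking_times_midpoint:
  assumes "f \<in> A" "\<And>x. cmod (f x) \<le> 1"
  shows "(\<lambda>x. f x * ((1 + f x) / 2)) \<in> peaking A"
proof -
  have "f x * ((1 + f x) / 2) = 1 \<or> cmod (f x * ((1 + f x) / 2)) < 1" for x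
  proof (cases "f x = 1")
    case False
    have "cmod (f x) * cmod ((1 + f x) / 2) \<le> cmod ((1 + f x) / 2)"
      using assms(2)[of x] by (intro mult_left_le_one_le) auto
    with norm_midpoint_1_less[OF assms(2) False] show ?thesis unfolding norm_mult by linarith
  qed simp
  then show ?thesis
    unfolding peaking_def using mult[OF assms(1) divide[OF add[OF const assms(1)]]] by blast
qed

text \<open>With the converse below, the peaking functions that attain 1 are those with peripheral
  range {1}; in this form they pass through the hypothesis on peripheral ranges.\<close>

lemma peripheral_range_peaking:
  assumes "f \<in> peaking A" "f x = 1"
  shows "peripheral_range f = {1}"
proof -
  have "sup_norm f = 1"
    using sup_norm_le[of f 1] peaking_norm_le[OF assms(1)]
      norm_le_sup_norm[OF peaking_mem[OF assms(1)], of x] assms(2) by force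
  then show ?thesis
    using peaking_eq_1[OF assms(1)] assms(2) unfolding peripheral_range_def by force
qed

lemma peaking_if_peripheral_range:
  assumes "f \<in> A" "peripheral_range f = {1}"
  shows "f \<in> peaking A"
proof -
  have "1 \<in> peripheral_range f" using assms(2) by simp
  then have "sup_norm f = 1" unfolding peripheral_range_def by auto
  moreover have "f x = 1" if "cmod (f x) = sup_norm f" for x
    using that assms(2) unfolding peripheral_range_def by blast
  ultimately show ?thesis
    using norm_le_sup_norm[OF assms(1)] assms(1) unfolding peaking_def
    by (auto simp: order_le_less)
qed

lemma closed_eq_1: "f \<in> A \<Longrightarrow> closed {x. f x = 1}"
  by (intro closed_Collect_eq continuous continuous_on_const)

lemma open_norm_less: "f \<in> A \<Longrightarrow> open {x. cmod (f x) < c}"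
  by (intro open_Collect_less continuous_on_norm continuous continuous_on_const)

end

subsection \<open>Strong boundary points\<close>

context compact_uniform_algebra
begin

text \<open>By compactness finitely many peaking functions suffice off \<open>U\<close>. Their
  product has maximum modulus below 1 there, and a high power brings it below \<open>e\<close> while
  keeping the value 1 on \<open>E\<close>.\<close>

lemma peaking_small_off:
  assumes E: "\<And>x. x \<notin> E \<Longrightarrow> \<exists>f\<in>peaking A. (\<forall>y\<in>E. f y = 1) \<and> f x \<noteq> 1"
    and U: "open U" "E \<subseteq> U" and e: "0 < (e::real)"
  shows "\<exists>f\<in>peaking A. (\<forall>y\<in>E. f y = 1) \<and> (\<forall>x. x \<notin> U \<longrightarrow> cmod (f x) < e)"
proof -
  define P where "P = {f \<in> peaking A. \<forall>y\<in>E. f y = 1}"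
  have K: "compact (- U)"
    using closed_Int_compact[OF _ compact_UNIV, of "- U"] U(1) by (simp add: closed_Compl)
  have "- U \<subseteq> (\<Union>f\<in>P. {x. cmod (f x) < 1})"
  proof
    fix x assume "x \<in> - U"
    then obtain f where "f \<in> peaking A" "\<forall>y\<in>E. f y = 1" "f x \<noteq> 1" using E[of x] U(2) by blast
    then show "x \<in> (\<Union>f\<in>P. {x. cmod (f x) < 1})"
      using peaking_norm_less[of f A x] by (auto simp: P_def)
  qed
  then obtain D where D: "D \<subseteq> P" "finite D" "- U \<subseteq> (\<Union>f\<in>D. {x. cmod (f x) < 1})"
    by (rule compactE_image[OF K, rotated])
       (auto simp: P_def peaking_def intro!: open_norm_less)
  \<comment> \<open>The witness is the product over \<open>D\<close>: the other factors have modulus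
    at most 1, so each single factor dominates it.\<close>
  have "\<exists>g\<in>P. \<forall>f\<in>D. \<forall>x. cmod (g x) \<le> cmod (f x)"
    using D(2,1)
  proof (induction D rule: finite_induct)
    case empty
    show ?case using peaking_1 unfolding P_def by auto
  next
    case (insert f D)
    then obtain g where g: "g \<in> P" "\<forall>f\<in>D. \<forall>x. cmod (g x) \<le> cmod (f x)" and f: "f \<in> P" by auto
    have le: "cmod (f x * g x) \<le> cmod (f x)" "cmod (f x * g x) \<le> cmod (g x)" for x
      using f g(1) peaking_norm_le unfolding P_def norm_mult
      by (auto intro!: mult_left_le mult_left_le_one_le)
    show ?case
    proof (intro bexI[of _ "\<lambda>x. f x * g x"] ballI allI)
      show "(\<lambda>x. f x * g x) \<in> P" using f g(1) unfolding P_def by (auto intro: peaking_mult)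
      show "cmod (f x * g x) \<le> cmod (k x)" if "k \<in> insert f D" for k x
        using le[of x] g(2) that by (auto intro: order_trans[OF le(2)])
    qed
  qed
  then obtain g where g: "g \<in> P" "\<And>f x. f \<in> D \<Longrightarrow> cmod (g x) \<le> cmod (f x)" by blast
  have less1: "cmod (g x) < 1" if "x \<notin> U" for x
    using that D(3) g(2)[of _ x] by fastforce
  have "\<exists>r. 0 \<le> r \<and> r < 1 \<and> (\<forall>x. x \<notin> U \<longrightarrow> cmod (g x) \<le> r)"
  proof (cases "- U = {}")
    case True
    then show ?thesis by (intro exI[of _ 0]) auto
  next
    case False
    have "continuous_on (- U) (\<lambda>x. cmod (g x))"
      using g(1) by (auto simp: P_def peaking_def intro!: continuous_on_norm
          intro: continuous_on_subset[OF continuous])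
    from continuous_attains_sup[OF K False this] obtain x where "x \<notin> U" "\<forall>y\<in>-U. cmod (g y) \<le> cmod (g x)"
      by auto
    then show ?thesis using less1 by (intro exI[of _ "cmod (g x)"]) auto
  qed
  then obtain r where r: "0 \<le> r" "r < 1" "\<And>x. x \<notin> U \<Longrightarrow> cmod (g x) \<le> r" by blast
  obtain n where n: "r ^ n < e" using real_arch_pow_inv[OF e r(2)] by blast
  show ?thesis
  proof (intro bexI[of _ "\<lambda>x. g x ^ n"] conjI allI impI ballI)
    show "(\<lambda>x. g x ^ n) \<in> peaking A" using g(1) peaking_power by (auto simp: P_def)
    show "g y ^ n = 1" if "y \<in> E" for y using g(1) that by (simp add: P_def)
    show "cmod (g x ^ n) < e" if "x \<notin> U" for x
      using power_mono[OF r(3)[OF that], of n] n by (simp add: norm_power)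
  qed
qed

text \<open>Bishop's construction: the factors \<open>f n\<close> of the series below are tiny where
  \<open>cmod h\<close> exceeds \<open>1 + 1/2^(n+1)\<close>, which compensates the growth of \<open>h\<close> away from \<open>E\<close>.\<close>

lemma bishop_multiplier:
  assumes E: "\<And>x. x \<notin> E \<Longrightarrow> \<exists>f\<in>peaking A. (\<forall>y\<in>E. f y = 1) \<and> f x \<noteq> 1"
    and h: "h \<in> A" "\<And>x. x \<in> E \<Longrightarrow> cmod (h x) \<le> 1"
  shows "\<exists>g\<in>A. (\<forall>x\<in>E. g x = 1) \<and> (\<forall>x. cmod (g x) \<le> 1) \<and> (\<forall>x. cmod (g x * h x) \<le> 1)"
proof -
  let ?w = "\<lambda>m::nat. (1/2 :: real) ^ Suc m"
  obtain M where M: "0 \<le> M" "\<And>x. cmod (h x) \<le> M"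
    using norm_le_sup_norm[OF h(1)] norm_ge_zero order_trans by metis
  \<comment> \<open>The minimum provides both smallness conditions of
    \<open>norm_binary_series_le\<close> at once.\<close>
  have "\<exists>f\<in>peaking A. (\<forall>y\<in>E. f y = 1) \<and>
      (\<forall>x. x \<notin> {x. cmod (h x) < 1 + ?w n} \<longrightarrow> cmod (f x) < min (?w n) (1 / (1 + M)))" for n
  proof (rule peaking_small_off[OF E])
    show "E \<subseteq> {x. cmod (h x) < 1 + ?w n}"
      using h(2) by (auto intro: le_less_trans[of _ 1])
  qed (use M open_norm_less[OF h(1)] in auto)
  then obtain f where f: "\<And>n. f n \<in> peaking A" "\<And>n y. y \<in> E \<Longrightarrow> f n y = 1"
    and fs: "\<And>n x. 1 + ?w n \<le> cmod (h x) \<Longrightarrow> cmod (f n x) \<le> ?w n \<and> cmod (f n x) \<le> 1 / (1 + M)"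
    by (metis (no_types, lifting) leD less_eq_real_def mem_Collect_eq min_less_iff_conj)
  define g where "g x = (\<Sum>n. (1/2) ^ Suc n * f n x)" for x
  have f1: "cmod (f n x) \<le> 1" for n x using peaking_norm_le[OF f(1)] .
  have "uniform_limit UNIV (\<lambda>n x. \<Sum>i<n. (1/2) ^ Suc i * f i x) (\<lambda>x. \<Sum>i. (1/2) ^ Suc i * f i x) sequentially"
  proof (rule Weierstrass_m_test)
    show "summable ?w" using power_half_series by (simp only: sums_iff)
    show "cmod ((1/2) ^ Suc n * f n x) \<le> ?w n" for n x
      using f1[of n x] by (simp add: norm_mult norm_power norm_divide mult_left_le)
  qed
  then have "g \<in> A"
    unfolding g_def by (rule uniform_limit[rotated]) (intro sum_mem finite_lessThan scale f(1)[THEN peaking_mem])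
  moreover have "g x = 1" if "x \<in> E" for x
  proof -
    have "(\<lambda>n. complex_of_real (?w n)) sums complex_of_real 1"
      using power_half_series by (simp only: sums_of_real_iff)
    then show ?thesis using f(2)[OF that] by (simp add: g_def sums_iff)
  qed
  moreover have "cmod (g x) \<le> 1" for x
  proof -
    \<comment> \<open>With \<open>s\<close> = 0 the smallness hypothesis of the series estimate is
      vacuous.\<close>
    have "\<not> ?w m \<le> 0" for m by (simp add: not_le)
    then show ?thesis
      using norm_binary_series_le[of "\<lambda>n. f n x" 0 M] f1 M(1) unfolding g_def by simp
  qed
  moreover have "cmod (g x * h x) \<le> 1" for x
  proof -
    have "(1 + (cmod (h x) - 1)) * cmod (g x) \<le> 1"
      unfolding g_def
    proof (rule norm_binary_series_le[where M = M])
      show "cmod (f m x) \<le> ?w m \<and> cmod (f m x) \<le> 1 / (1 + M)" if "?w m \<le> cmod (h x) - 1" for m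
        using fs[of m x] that by linarith
      show "cmod (h x) - 1 \<le> M" using M(2)[of x] by linarith
    qed (use f1 M in auto)
    then show ?thesis by (simp add: norm_mult mult.commute)
  qed
  ultimately show ?thesis by blast
qed

text \<open>A maximal family with the finite intersection property has only one common peak point, since
  otherwise a function separating two of them could be turned into a further member.\<close>

lemma strong_boundary_common_peak_point:
  assumes F: "F \<subseteq> peaking A"
    and F_fip: "\<And>D. finite D \<Longrightarrow> D \<subseteq> F \<Longrightarrow> \<exists>x. \<forall>f\<in>D. f x = 1"
  shows "\<exists>x\<in>strong_boundary A. \<forall>f\<in>F. f x = 1"
proof -
  define fip where "fip G \<longleftrightarrow> (\<forall>D. finite D \<longrightarrow> D \<subseteq> G \<longrightarrow> (\<exists>x. \<forall>f\<in>D. f x = 1))"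
    for G :: "('x \<Rightarrow> complex) set"
  define \<A> where "\<A> = {G. F \<subseteq> G \<and> G \<subseteq> peaking A \<and> fip G}"
  have "F \<in> \<A>" using F F_fip by (simp add: \<A>_def fip_def)
  have "\<exists>G\<in>\<A>. \<forall>X\<in>\<A>. G \<subseteq> X \<longrightarrow> X = G"
  proof (rule subset_Zorn_nonempty)
    show "\<A> \<noteq> {}" using \<open>F \<in> \<A>\<close> by auto
    fix \<C> assume C: "\<C> \<noteq> {}" "subset.chain \<A> \<C>"
    have CA: "F \<subseteq> G" "G \<subseteq> peaking A" "fip G" if "G \<in> \<C>" for G
      using C(2) that by (auto simp: subset.chain_def \<A>_def)
    have "fip (\<Union>\<C>)"
      unfolding fip_def
    proof (intro allI impI)
      fix D assume D: "finite D" "D \<subseteq> \<Union>\<C>"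
      obtain G where "G \<in> \<C>" "D \<subseteq> G"
        using finite_subset_Union_chain[OF D C] by metis
      then show "\<exists>x. \<forall>f\<in>D. f x = 1" using CA(3) D(1) unfolding fip_def by simp
    qed
    moreover have "\<Union>\<C> \<subseteq> peaking A" by (rule Union_least) (rule CA(2))
    moreover obtain G where "G \<in> \<C>" using C(1) by auto
    then have "F \<subseteq> \<Union>\<C>" using order_trans[OF CA(1) Union_upper] by simp
    ultimately show "\<Union>\<C> \<in> \<A>" unfolding \<A>_def by simp
  qed
  then obtain G where G: "G \<in> \<A>" and Gmax: "\<And>X. X \<in> \<A> \<Longrightarrow> G \<subseteq> X \<Longrightarrow> X = G" by metis
  have FG: "F \<subseteq> G" and Gpk: "G \<subseteq> peaking A" and Gfip: "fip G" using G by (simp_all add: \<A>_def)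
  \<comment> \<open>The common peak set of the maximal family: nonempty by compactness, and to be
    shown a singleton.\<close>
  define E where "E = {x. \<forall>f\<in>G. f x = 1}"
  have E_Int: "E = UNIV \<inter> \<Inter>((\<lambda>f. {x. f x = 1}) ` G)" unfolding E_def by auto
  have "E \<noteq> {}"
    unfolding E_Int
  proof (rule compact_imp_fip_image[OF compact_UNIV])
    show "closed {x. f x = 1}" if "f \<in> G" for f
      using closed_eq_1[OF peaking_mem[OF subsetD[OF Gpk that]]] .
    show "UNIV \<inter> \<Inter>((\<lambda>f. {x. f x = 1}) ` D) \<noteq> {}" if D: "finite D" "D \<subseteq> G" for D
    proof -
      have "\<exists>x. \<forall>f\<in>D. f x = 1" using Gfip D unfolding fip_def by simp
      then obtain x where "\<forall>f\<in>D. f x = 1" ..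
      then have "x \<in> UNIV \<inter> \<Inter>((\<lambda>f. {x. f x = 1}) ` D)" by simp
      then show ?thesis by auto
    qed
  qed
  have Ehull: "\<exists>f\<in>peaking A. (\<forall>y\<in>E. f y = 1) \<and> f x \<noteq> 1" if "x \<notin> E" for x
  proof -
    from that obtain f where "f \<in> G" "f x \<noteq> 1" by (auto simp: E_def)
    then show ?thesis using subsetD[OF Gpk] by (intro bexI[of _ f]) (auto simp: E_def)
  qed
  have "compact E"
  proof -
    have "closed E" unfolding E_Int
      by (intro closed_Int closed_UNIV closed_INT ballI closed_eq_1 peaking_mem subsetD[OF Gpk])
    then show ?thesis using closed_Int_compact[OF _ compact_UNIV] by force
  qed
  have unique: "x = y" if xy: "x \<in> E" "y \<in> E" for x y
  proof (rule ccontr)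
    assume "x \<noteq> y"
    \<comment> \<open>Normalise \<open>f\<close> at a point \<open>z\<close> where |f| is largest on
      \<open>E\<close>. Bishop's multiplier then yields a peaking function \<open>k\<close> with
      value 1 at \<open>z\<close>, so maximality puts \<open>k\<close> into \<open>G\<close>; but
      f(x) = 0 makes k(x) = 1/2.\<close>
    then obtain f where f: "f \<in> A" "f x = 0" "f y = 1" using separating_function by blast
    obtain z where z: "z \<in> E" "\<And>w. w \<in> E \<Longrightarrow> cmod (f w) \<le> cmod (f z)"
      using continuous_attains_sup[OF \<open>compact E\<close> \<open>E \<noteq> {}\<close>, of "\<lambda>x. cmod (f x)"]
        continuous_on_norm[OF continuous_on_subset[OF continuous[OF f(1)] subset_UNIV]] by blast
    have fz: "f z \<noteq> 0" using z(2)[OF xy(2)] f(3) by auto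
    let ?h = "\<lambda>w. f w / f z"
    have h: "?h \<in> A" "\<And>w. w \<in> E \<Longrightarrow> cmod (?h w) \<le> 1"
      using z fz by (auto simp: norm_divide intro!: divide f)
    obtain g where g: "g \<in> A" "\<And>w. w \<in> E \<Longrightarrow> g w = 1" "\<And>w. cmod (g w * ?h w) \<le> 1"
      using bishop_multiplier[OF Ehull h] by blast
    define k where "k w = (1 + g w * ?h w) / 2" for w
    have k: "k \<in> peaking A" unfolding k_def by (rule peaking_midpoint[OF mult[OF g(1) h(1)] g(3)])
    have kz: "k z = 1" using g(2)[OF z(1)] fz by (simp add: k_def)
    have "f z = 1" if "f \<in> insert k G" for f using that kz z(1) by (auto simp: E_def)
    then have "fip (insert k G)" unfolding fip_def by (intro allI impI exI[of _ z] ballI) (blast)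
    then have "insert k G \<in> \<A>" using FG Gpk k by (auto simp: \<A>_def)
    then have "insert k G = G" by (rule Gmax) auto
    then have "k \<in> G" by auto
    then have "k x = 1" using xy(1) by (simp add: E_def)
    then show False by (simp add: k_def f(2))
  qed
  obtain x where x: "x \<in> E" using \<open>E \<noteq> {}\<close> by blast
  have "x \<in> strong_boundary A"
    unfolding strong_boundary_def
  proof (intro CollectI allI impI)
    fix y assume "\<forall>f\<in>peaking A. f x = 1 \<longrightarrow> f y = 1"
    then have "y \<in> E" using x subsetD[OF Gpk] by (simp add: E_def)
    then show "y = x" by (rule unique[OF _ x])
  qed
  then show ?thesis using x subsetD[OF FG] by (intro bexI[of _ x]) (auto simp: E_def)
qed

lemma strong_boundary_peak_point:
  assumes "f \<in> peaking A" "f z = 1"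
  shows "\<exists>x\<in>strong_boundary A. f x = 1"
  using strong_boundary_common_peak_point[of "{f}"] assms by blast

text \<open>A nonzero \<open>f\<close>, divided by a value of maximal modulus and averaged with 1,
  is a peaking function. It peaks at some strong boundary point, where \<open>f\<close> takes that
  same nonzero value.\<close>

lemma eq_0_if_strong_boundary:
  assumes f: "f \<in> A" "\<And>x. x \<in> strong_boundary A \<Longrightarrow> f x = 0"
  shows "f = (\<lambda>_. 0)"
proof (rule ccontr)
  assume "f \<noteq> (\<lambda>_. 0)"
  then obtain w where w: "f w \<noteq> 0" by auto
  obtain z where z: "cmod (f z) = sup_norm f" using sup_norm_attained[OF f(1)] by blast
  have fz: "f z \<noteq> 0" using norm_le_sup_norm[OF f(1), of w] w z by auto
  have "(\<lambda>x. (1 + f x / f z) / 2) \<in> peaking A"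
  proof (rule peaking_midpoint[OF divide[OF f(1)]])
    show "cmod (f x / f z) \<le> 1" for x
      using norm_le_sup_norm[OF f(1), of x] fz by (simp add: norm_divide flip: z)
  qed
  from strong_boundary_peak_point[OF this, of z] fz
  obtain x where "x \<in> strong_boundary A" "(1 + f x / f z) / 2 = 1" by auto
  then show False using f(2) by auto
qed

lemma eq_if_strong_boundary:
  assumes "f \<in> A" "g \<in> A" "\<And>x. x \<in> strong_boundary A \<Longrightarrow> f x = g x"
  shows "f = g"
proof -
  have "(\<lambda>x. f x - g x) = (\<lambda>_. 0)"
    by (rule eq_0_if_strong_boundary[OF diff[OF assms(1,2)]]) (simp add: assms(3))
  then show ?thesis by (simp add: fun_eq_iff)
qed

text \<open>This is the form in which the constructions for a set \<open>E\<close> apply to a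
  singleton.\<close>

lemma strong_boundary_hull:
  "x \<in> strong_boundary A \<Longrightarrow> y \<notin> {x} \<Longrightarrow> \<exists>f\<in>peaking A. (\<forall>z\<in>{x}. f z = 1) \<and> f y \<noteq> 1"
  unfolding strong_boundary_def by blast

text \<open>Bishop's multiplier \<open>g\<close> bounds both g and gh by 1. Multiplying by both
  midpoints (1 + g)/2 and (1 + gh)/2 makes the new multiplier and its product with h peaking
  simultaneously.\<close>

lemma bishop_peaking:
  assumes x: "x \<in> strong_boundary A" and f: "f \<in> A" "f x \<noteq> 0"
  shows "\<exists>g\<in>peaking A. g x = 1 \<and> (\<lambda>z. f z * g z / f x) \<in> peaking A"
proof -
  let ?h = "\<lambda>z. f z / f x"
  have h: "?h \<in> A" by (rule divide[OF f(1)])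
  obtain g where g: "g \<in> A" "g x = 1" "\<And>z. cmod (g z) \<le> 1" "\<And>z. cmod (g z * ?h z) \<le> 1"
    using bishop_multiplier[OF strong_boundary_hull[OF x] h] f(2) by auto
  let ?m = "\<lambda>z. (1 + g z) / 2" and ?n = "\<lambda>z. (1 + g z * ?h z) / 2"
  have "(\<lambda>z. g z * ?m z * ?n z) \<in> peaking A"
    by (rule peaking_mult[OF peaking_times_midpoint[OF g(1,3)] peaking_midpoint[OF mult[OF g(1) h] g(4)]])
  moreover have "(\<lambda>z. (g z * ?h z) * ?n z * ?m z) \<in> peaking A"
    by (rule peaking_mult[OF peaking_times_midpoint[OF mult[OF g(1) h] g(4)] peaking_midpoint[OF g(1,3)]])
  then have "(\<lambda>z. f z * (g z * ?m z * ?n z) / f x) \<in> peaking A"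
    by (simp add: field_simps)
  ultimately show ?thesis
    using g(2) f(2) by (intro bexI[of _ "\<lambda>z. g z * ?m z * ?n z"]) auto
qed

text \<open>The factor g has modulus at most 1 where |f| < e and below e/M elsewhere. Hence sup
  norms of products with peaking functions recover the value of |f| at \<open>x\<close>.\<close>

lemma peaking_small_product:
  assumes x: "x \<in> strong_boundary A" and f: "f \<in> A" "cmod (f x) < e"
  shows "\<exists>g\<in>peaking A. g x = 1 \<and> (\<forall>z. cmod (f z * g z) \<le> e)"
proof -
  have e: "0 < e" using f(2) norm_ge_zero[of "f x"] by linarith
  obtain M where M: "0 < M" "\<And>x. cmod (f x) \<le> M"
    using norm_le_sup_norm[OF f(1)] by (metis less_max_iff_disj max.cobounded1 order.trans zero_less_one max.commute)
  have "0 < e / M" using e M by simp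
  then obtain g where g: "g \<in> peaking A" "g x = 1" "\<And>z. \<not> cmod (f z) < e \<Longrightarrow> cmod (g z) < e / M"
    using peaking_small_off[OF strong_boundary_hull[OF x] open_norm_less[OF f(1)], of e "e / M"] f(2) by auto
  have "cmod (f z * g z) \<le> e" for z
  proof (cases "cmod (f z) < e")
    case True
    have "cmod (f z) * cmod (g z) \<le> e * 1"
      using True e peaking_norm_le[OF g(1)] by (intro mult_mono) auto
    then show ?thesis by (simp add: norm_mult)
  next
    case False
    have "cmod (f z) * cmod (g z) \<le> M * (e / M)"
      using M e g(3)[OF False] by (intro mult_mono) auto
    then show ?thesis using M by (simp add: norm_mult)
  qed
  with g(1,2) show ?thesis by blast
qed

text \<open>Test functions peaking at \<open>x\<close> that keep |gh| below |g(x)| + e localise the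
  sup norms at \<open>x\<close>.\<close>

lemma norm_le_if_sup_norm_le:
  assumes f: "f \<in> A" and g: "g \<in> A" and x: "x \<in> strong_boundary A"
    and le: "\<And>h. h \<in> A \<Longrightarrow> sup_norm (\<lambda>z. f z * h z) \<le> sup_norm (\<lambda>z. g z * h z)"
  shows "cmod (f x) \<le> cmod (g x)"
proof (rule field_le_epsilon)
  fix e :: real assume "0 < e"
  then obtain h where h: "h \<in> peaking A" "h x = 1" "\<And>z. cmod (g z * h z) \<le> cmod (g x) + e"
    using peaking_small_product[OF x g, of "cmod (g x) + e"] by auto
  have "cmod (f x) \<le> sup_norm (\<lambda>z. f z * h z)"
    using norm_le_sup_norm[OF mult[OF f peaking_mem[OF h(1)]], of x] h(2) by simp
  also have "\<dots> \<le> cmod (g x) + e"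
    using le[OF peaking_mem[OF h(1)]] sup_norm_le[of "\<lambda>z. g z * h z", OF h(3)] by linarith
  finally show "cmod (f x) \<le> cmod (g x) + e" .
qed

end

subsection \<open>Pairs of maps preserving peripheral ranges of products\<close>

text \<open>Families indexed by \<open>I\<close>, rather than maps between \<open>A\<close> and \<open>B\<close>, keep the situation symmetric in
  the two algebras although \<open>T\<close> is not known to be injective.\<close>

locale peripheral_pair =
  A: compact_uniform_algebra A + B: compact_uniform_algebra B
  for A :: "('x::t2_space \<Rightarrow> complex) set" and B :: "('y::t2_space \<Rightarrow> complex) set" +
  fixes I :: "'i set"
    and p q :: "'i \<Rightarrow> 'x \<Rightarrow> complex" and p' q' :: "'i \<Rightarrow> 'y \<Rightarrow> complex"
  assumes p: "p ` I = A" and q: "q ` I = A" and p': "p' ` I = B" and q': "q' ` I = B"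
    and peripheral: "\<And>i j. i \<in> I \<Longrightarrow> j \<in> I \<Longrightarrow>
      peripheral_range (\<lambda>x. p i x * q j x) = peripheral_range (\<lambda>y. p' i y * q' j y)"
begin

lemma mem: "i \<in> I \<Longrightarrow> p i \<in> A" "i \<in> I \<Longrightarrow> q i \<in> A" "i \<in> I \<Longrightarrow> p' i \<in> B" "i \<in> I \<Longrightarrow> q' i \<in> B"
  using p q p' q' by auto

text \<open>This symmetry and the next give every later lemma in four versions.\<close>

lemma exchange: "peripheral_pair A B I q p q' p'"
  by unfold_locales (use p q p' q' peripheral in \<open>auto simp: mult.commute\<close>)

lemma reverse: "peripheral_pair B A I p' q' p q"
  by unfold_locales (use p q p' q' peripheral in auto)

lemma sup_norm_eq:
  assumes "i \<in> I" "j \<in> I"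
  shows "sup_norm (\<lambda>x. p i x * q j x) = sup_norm (\<lambda>y. p' i y * q' j y)"
proof -
  obtain z where "z \<in> peripheral_range (\<lambda>x. p i x * q j x)"
    using A.peripheral_range_nonempty[OF A.mult[OF mem(1,2)]] assms by blast
  then show ?thesis using peripheral[OF assms] unfolding peripheral_range_def by auto
qed

text \<open>Pointwise domination gives domination of the sup norms of all products with
  \<open>q j\<close>. These norms are preserved, and in \<open>B\<close> they can be localised at
  \<open>y\<close>.\<close>

lemma norm_le_transfer:
  assumes i: "i \<in> I" "k \<in> I" and le: "\<And>x. cmod (p i x) \<le> cmod (p k x)" and y: "y \<in> strong_boundary B"
  shows "cmod (p' i y) \<le> cmod (p' k y)"
proof (rule B.norm_le_if_sup_norm_le[OF mem(3,3) y])
  fix h assume "h \<in> B"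
  then obtain j where j: "j \<in> I" "h = q' j" using q' by blast
  have "sup_norm (\<lambda>x. p i x * q j x) \<le> sup_norm (\<lambda>x. p k x * q j x)"
  proof (rule A.sup_norm_le)
    show "cmod (p i x * q j x) \<le> sup_norm (\<lambda>x. p k x * q j x)" for x
      using mult_right_mono[OF le, of "cmod (q j x)"] A.norm_le_sup_norm[OF A.mult[OF mem(1,2)], of k j x] i j
      by (simp add: norm_mult) (meson norm_ge_zero order_trans)
  qed
  then show "sup_norm (\<lambda>z. p' i z * h z) \<le> sup_norm (\<lambda>z. p' k z * h z)"
    using sup_norm_eq i j by simp
qed (use i in auto)

text \<open>Stated with the product only, the condition is symmetric in \<open>p\<close> and \<open>q\<close>; the individual values
  \<open>p' i y\<close> and \<open>q' j y\<close> are determined only up to mutually inverse factors.\<close>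

definition matched :: "'x \<Rightarrow> 'y \<Rightarrow> bool" where
  "matched x y \<longleftrightarrow> (\<forall>i\<in>I. \<forall>j\<in>I. p i \<in> peaking A \<longrightarrow> q j \<in> peaking A \<longrightarrow> p i x = 1 \<longrightarrow> q j x = 1
     \<longrightarrow> p' i y * q' j y = 1)"

text \<open>The products \<open>p' i * q' j\<close> coming from functions peaking at
  \<open>x\<close> are peaking functions in \<open>B\<close>. Once they have the finite intersection
  property, they share a strong boundary peak point.\<close>

lemma matched_exists:
  assumes x: "x \<in> strong_boundary A"
  shows "\<exists>y\<in>strong_boundary B. matched x y"
proof -
  define Ip where "Ip = {i \<in> I. p i \<in> peaking A \<and> p i x = 1}"
  define Iq where "Iq = {j \<in> I. q j \<in> peaking A \<and> q j x = 1}"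
  define r where "r ij y = p' (fst ij) y * q' (snd ij) y" for ij y
  interpret ex: peripheral_pair A B I q p q' p' by (rule exchange)
  have r_peaking: "r ij \<in> peaking B" "\<exists>y. r ij y = 1" if "ij \<in> Ip \<times> Iq" for ij
  proof -
    from that obtain i j where ij: "ij = (i, j)" "i \<in> Ip" "j \<in> Iq" by blast
    have "peripheral_range (\<lambda>x. p i x * q j x) = {1}"
      by (rule A.peripheral_range_peaking[OF A.peaking_mult, where x = x]) (use ij in \<open>auto simp: Ip_def Iq_def\<close>)
    then have 1: "peripheral_range (r ij) = {1}"
      using peripheral ij unfolding r_def Ip_def Iq_def by simp
    have "r ij \<in> B" unfolding r_def by (rule B.mult) (use ij mem in \<open>auto simp: Ip_def Iq_def\<close>)
    then show "r ij \<in> peaking B" using 1 by (rule B.peaking_if_peripheral_range)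
    have "1 \<in> peripheral_range (r ij)" using 1 by simp
    then have "1 \<in> range (r ij)" unfolding peripheral_range_def by simp
    then show "\<exists>y. r ij y = 1" by (metis rangeE)
  qed
  \<comment> \<open>The index maps are not multiplicative, so a product in \<open>A\<close> need not
    correspond to a product in \<open>B\<close>. It still yields a pair whose image is dominated in
    modulus by the given ones on the strong boundary.\<close>
  have dom: "\<exists>ij\<in>Ip \<times> Iq. \<forall>kl\<in>D. \<forall>y\<in>strong_boundary B. cmod (r ij y) \<le> cmod (r kl y)"
    if "finite D" "D \<subseteq> Ip \<times> Iq" for D
    using that
  proof (induction D rule: finite_induct)
    case empty
    obtain i j where "i \<in> I" "p i = (\<lambda>_. 1)" "j \<in> I" "q j = (\<lambda>_. 1)"
      using p q A.const[of 1] by (metis (no_types, lifting) imageE)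
    then have "(i, j) \<in> Ip \<times> Iq" using A.peaking_1 by (simp add: Ip_def Iq_def)
    then show ?case by blast
  next
    case (insert kl D)
    obtain k l where kl: "kl = (k, l)" "k \<in> Ip" "l \<in> Iq" using insert.prems by auto
    obtain i j where ij: "i \<in> Ip" "j \<in> Iq" "\<forall>kl\<in>D. \<forall>y\<in>strong_boundary B. cmod (r (i, j) y) \<le> cmod (r kl y)"
      using insert by auto
    have pk: "(\<lambda>x. p i x * p k x) \<in> peaking A" "(\<lambda>x. q j x * q l x) \<in> peaking A"
      using ij kl by (auto simp: Ip_def Iq_def intro: A.peaking_mult)
    obtain m where m: "m \<in> I" "p m = (\<lambda>x. p i x * p k x)" using pk(1) A.peaking_mem p by (metis (no_types, lifting) imageE)
    obtain n where n: "n \<in> I" "q n = (\<lambda>x. q j x * q l x)" using pk(2) A.peaking_mem q by (metis (no_types, lifting) imageE)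
    have mn: "(m, n) \<in> Ip \<times> Iq" using pk m n ij kl by (simp add: Ip_def Iq_def)
    have le: "cmod (p m x) \<le> cmod (p i x)" "cmod (p m x) \<le> cmod (p k x)"
      "cmod (q n x) \<le> cmod (q j x)" "cmod (q n x) \<le> cmod (q l x)" for x
      using ij kl peaking_norm_le unfolding m n norm_mult Ip_def Iq_def
      by (auto intro!: mult_left_le mult_left_le_one_le)
    have r_le: "cmod (r (m, n) y) \<le> cmod (r (i, j) y)" "cmod (r (m, n) y) \<le> cmod (r (k, l) y)"
      if y: "y \<in> strong_boundary B" for y
      unfolding r_def fst_conv snd_conv norm_mult
      by (intro mult_mono norm_ge_zero norm_le_transfer ex.norm_le_transfer y le;
          use m n ij kl in \<open>simp add: Ip_def Iq_def\<close>)+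
    then show ?case using mn kl(1) ij(3)
      by (intro bexI[of _ "(m, n)"]) (auto intro: order_trans[OF r_le(1)])
  qed
  have "\<exists>y\<in>strong_boundary B. \<forall>f\<in>r ` (Ip \<times> Iq). f y = 1"
  proof (rule B.strong_boundary_common_peak_point)
    show "r ` (Ip \<times> Iq) \<subseteq> peaking B" using r_peaking by blast
    fix D assume "finite D" "D \<subseteq> r ` (Ip \<times> Iq)"
    then obtain D' where D': "finite D'" "D' \<subseteq> Ip \<times> Iq" "D = r ` D'"
      by (meson finite_subset_image)
    obtain ij where ij: "ij \<in> Ip \<times> Iq" "\<forall>kl\<in>D'. \<forall>y\<in>strong_boundary B. cmod (r ij y) \<le> cmod (r kl y)"
      using dom[OF D'(1,2)] by blast
    obtain y where y: "y \<in> strong_boundary B" "r ij y = 1"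
      using r_peaking[OF ij(1)] B.strong_boundary_peak_point by blast
    \<comment> \<open>Where the dominated function equals 1, every dominating one has modulus at
      least 1, and being peaking it equals 1.\<close>
    have "r kl y = 1" if "kl \<in> D'" for kl
    proof (rule peaking_eq_1[of "r kl" B])
      show "r kl \<in> peaking B" using r_peaking D'(2) that by blast
      have "cmod (r ij y) \<le> cmod (r kl y)" using ij(2) y(1) that by blast
      then show "1 \<le> cmod (r kl y)" by (simp add: y(2))
    qed
    then show "\<exists>x. \<forall>f\<in>D. f x = 1" using D'(3) by blast
  qed
  then obtain y where "y \<in> strong_boundary B" "\<And>i j. i \<in> Ip \<Longrightarrow> j \<in> Iq \<Longrightarrow> r (i, j) y = 1" by blast
  then show ?thesis unfolding matched_def by (intro bexI[of _ y]) (auto simp: r_def Ip_def Iq_def)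
qed

text \<open>Pairing \<open>q j\<close> and \<open>q j\<^sub>0\<close> with the constant 1 gives two
  products equal to 1, in which the common factor \<open>p' i\<^sub>0 y\<close> cancels.\<close>

lemma matched_q:
  assumes "matched x y" "i\<^sub>0 \<in> I" "p i\<^sub>0 = (\<lambda>_. 1)" "j\<^sub>0 \<in> I" "q j\<^sub>0 = (\<lambda>_. 1)"
    and "j \<in> I" "q j \<in> peaking A" "q j x = 1"
  shows "q' j y = q' j\<^sub>0 y"
proof -
  have "p' i\<^sub>0 y * q' j y = 1" "p' i\<^sub>0 y * q' j\<^sub>0 y = 1"
    using assms A.peaking_1 unfolding matched_def by auto
  then show ?thesis by (metis mult_cancel_left zero_neq_one mult_zero_left)
qed

text \<open>Test against a peaking \<open>q j\<close> that keeps the product with \<open>p i\<close>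
  below |p i x| + e. Its partner \<open>q' j\<close> has at \<open>y\<close> the same value as
  \<open>q' j\<^sub>0\<close>, and sup norms are preserved.\<close>

lemma matched_norm_le:
  assumes x: "x \<in> strong_boundary A"
    and m: "matched x y" "i\<^sub>0 \<in> I" "p i\<^sub>0 = (\<lambda>_. 1)" "j\<^sub>0 \<in> I" "q j\<^sub>0 = (\<lambda>_. 1)"
    and i: "i \<in> I"
  shows "cmod (p' i y) * cmod (q' j\<^sub>0 y) \<le> cmod (p i x)"
proof (rule field_le_epsilon)
  fix e :: real assume "0 < e"
  then obtain h where h: "h \<in> peaking A" "h x = 1" "\<And>z. cmod (p i z * h z) \<le> cmod (p i x) + e"
    using A.peaking_small_product[OF x mem(1)[OF i], of "cmod (p i x) + e"] by auto
  obtain j where j: "j \<in> I" "q j = h" using h(1) A.peaking_mem q by blast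
  have "cmod (p' i y) * cmod (q' j\<^sub>0 y) = cmod (p' i y * q' j y)"
    using matched_q[OF m j(1)] h j by (simp add: norm_mult)
  also have "\<dots> \<le> sup_norm (\<lambda>y. p' i y * q' j y)"
    using B.norm_le_sup_norm[OF B.mult[OF mem(3,4)], of i j y] i j by simp
  also have "\<dots> = sup_norm (\<lambda>x. p i x * q j x)" using sup_norm_eq[OF i j(1)] by simp
  also have "\<dots> \<le> cmod (p i x) + e" using h(3) j by (intro A.sup_norm_le) simp
  finally show "cmod (p' i y) * cmod (q' j\<^sub>0 y) \<le> cmod (p i x) + e" .
qed

text \<open>\<open>bishop_peaking\<close> supplies \<open>q j\<close> for which the product with
  \<open>p i\<close> has \<open>p i x\<close> as its only peripheral value. Equality of the moduli
  places the value at \<open>y\<close> in the corresponding peripheral range in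
  \<open>B\<close>.\<close>

lemma matched_eq:
  assumes x: "x \<in> strong_boundary A"
    and m: "matched x y" "i\<^sub>0 \<in> I" "p i\<^sub>0 = (\<lambda>_. 1)" "j\<^sub>0 \<in> I" "q j\<^sub>0 = (\<lambda>_. 1)"
    and i: "i \<in> I" and norm: "cmod (p' i y) * cmod (q' j\<^sub>0 y) = cmod (p i x)"
  shows "p' i y * q' j\<^sub>0 y = p i x"
proof (cases "p i x = 0")
  case True
  then show ?thesis using norm by auto
next
  case False
  then obtain h where h: "h \<in> peaking A" "h x = 1" "(\<lambda>z. p i z * h z / p i x) \<in> peaking A"
    using A.bishop_peaking[OF x mem(1)[OF i]] by blast
  obtain j where j: "j \<in> I" "q j = h" using h(1) A.peaking_mem q by blast
  have le: "cmod (p i z * q j z) \<le> cmod (p i x)" for z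
    using peaking_norm_le[OF h(3), of z] False j by (simp add: norm_divide)
  have eq: "p i z * q j z = p i x" if "cmod (p i z * q j z) = cmod (p i x)" for z
    using peaking_eq_1[OF h(3), of z] False j that by (simp add: norm_divide)
  have "sup_norm (\<lambda>z. p i z * q j z) = cmod (p i x)"
  proof (rule antisym[OF A.sup_norm_le[OF le]])
    show "cmod (p i x) \<le> sup_norm (\<lambda>z. p i z * q j z)"
      using A.norm_le_sup_norm[OF A.mult[OF mem(1,2)], of i j x] i j h(2) by simp
  qed
  then have "peripheral_range (\<lambda>z. p i z * q j z) \<subseteq> {p i x}"
    and "sup_norm (\<lambda>z. p' i z * q' j z) = cmod (p i x)"
    using sup_norm_eq[OF i j(1)] eq unfolding peripheral_range_def by auto
  then have range_le: "peripheral_range (\<lambda>z. p' i z * q' j z) \<subseteq> {p i x}"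
    and "sup_norm (\<lambda>z. p' i z * q' j z) = cmod (p i x)"
    using peripheral[OF i j(1)] by auto
  moreover have "q' j y = q' j\<^sub>0 y"
    using matched_q[OF m j(1)] h j by simp
  then have "p' i y * q' j\<^sub>0 y \<in> range (\<lambda>z. p' i z * q' j z)"
    by (intro range_eqI[of _ _ y]) simp
  moreover have "cmod (p' i y * q' j\<^sub>0 y) = cmod (p i x)" using norm by (simp add: norm_mult)
  ultimately have "p' i y * q' j\<^sub>0 y \<in> peripheral_range (\<lambda>z. p' i z * q' j z)"
    unfolding peripheral_range_def by simp
  then show ?thesis using range_le by auto
qed

text \<open>Match \<open>y\<close> with some \<open>x\<close> and \<open>x\<close> with some
  \<open>w\<close>. Composing the two norm inequalities forces w = y and turns both into equalities,
  so \<open>matched_eq\<close> applies; one \<open>x\<close> serves all indices.\<close>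

lemma strong_boundary_correspondence:
  assumes y: "y \<in> strong_boundary B"
    and i0: "i\<^sub>0 \<in> I" "p i\<^sub>0 = (\<lambda>_. 1)" and j0: "j\<^sub>0 \<in> I" "q j\<^sub>0 = (\<lambda>_. 1)"
  shows "\<exists>x. \<forall>i\<in>I. p' i y * q' j\<^sub>0 y = p i x \<and> q' i y * p' i\<^sub>0 y = q i x"
proof -
  interpret ex: peripheral_pair A B I q p q' p' by (rule exchange)
  interpret re: peripheral_pair B A I p' q' p q by (rule reverse)
  interpret rex: peripheral_pair B A I q' p' q p by (rule re.exchange)
  obtain x where x: "x \<in> strong_boundary A" "re.matched y x" using re.matched_exists[OF y] by blast
  obtain w where w: "w \<in> strong_boundary B" "matched x w" using matched_exists[OF x(1)] by blast
  have xs: "rex.matched y x" using x(2) unfolding re.matched_def rex.matched_def by (simp add: mult.commute)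
  have ws: "ex.matched x w" using w(2) unfolding matched_def ex.matched_def by (simp add: mult.commute)
  obtain i1 j1 where i1: "i1 \<in> I" "p' i1 = (\<lambda>_. 1)" and j1: "j1 \<in> I" "q' j1 = (\<lambda>_. 1)"
    using p' q' B.const[of 1] by (metis (no_types, lifting) imageE)
  have 1: "p' i\<^sub>0 w * q' j\<^sub>0 w = 1"
    using w(2) i0 j0 A.peaking_1 unfolding matched_def by auto
  have 2: "p i1 x * q j1 x = 1"
    using x(2) i1 j1 B.peaking_1 unfolding re.matched_def by auto
  note forward = matched_norm_le[OF x(1) w(2) i0 j0] ex.matched_norm_le[OF x(1) ws j0 i0]
  note backward = re.matched_norm_le[OF y x(2) i1 j1] rex.matched_norm_le[OF y xs j1 i1]
  let ?\<alpha> = "cmod (q' j\<^sub>0 w)" and ?\<beta> = "cmod (q j1 x)" and ?\<gamma> = "cmod (p' i\<^sub>0 w)" and ?\<delta> = "cmod (p i1 x)"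
  have prod: "?\<gamma> * ?\<alpha> = 1" "?\<delta> * ?\<beta> = 1" using 1 2 by (metis norm_mult norm_one)+
  then have pos: "0 < ?\<alpha>" "0 < ?\<beta>" "0 < ?\<gamma>" "0 < ?\<delta>" using norm_ge_zero by (auto simp: less_le)
  have le: "cmod (p' i w) * ?\<alpha> * ?\<beta> \<le> cmod (p' i y)" if "i \<in> I" for i
    using mult_right_mono[OF forward(1)[OF that], of ?\<beta>] backward(1)[OF that] by simp
  \<comment> \<open>Otherwise a function vanishing at \<open>y\<close> but not at \<open>w\<close>
    contradicts the composed inequality.\<close>
  have "w = y"
  proof (rule ccontr)
    assume "w \<noteq> y"
    then obtain f where "f \<in> B" "f y = 0" "f w = 1" using B.separating_function by metis
    then obtain i where "i \<in> I" "p' i y = 0" "p' i w = 1" using p' by blast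
    then show False using le[of i] pos by (simp add: mult_le_0_iff)
  qed
  \<comment> \<open>The index with image the constant 1 bounds each of the two products by 1. Since
    together they multiply to 1, both equal 1.\<close>
  have "?\<alpha> * ?\<beta> \<le> 1" using le[OF i1(1)] i1(2) by simp
  moreover have "?\<gamma> * ?\<delta> \<le> 1"
    using mult_right_mono[OF forward(2)[OF j1(1)], of ?\<delta>] backward(2)[OF j1(1)] j1(2) by simp
  moreover have "(?\<alpha> * ?\<beta>) * (?\<gamma> * ?\<delta>) = 1" using prod by algebra
  ultimately have \<alpha>\<beta>: "?\<alpha> * ?\<beta> = 1" and \<gamma>\<delta>: "?\<gamma> * ?\<delta> = 1"
    using pos mult_le_cancel_left1[of "?\<alpha> * ?\<beta>" "?\<gamma> * ?\<delta>"] mult_le_cancel_right1[of "?\<gamma> * ?\<delta>" "?\<alpha> * ?\<beta>"]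
    by auto
  have "p' i y * q' j\<^sub>0 y = p i x \<and> q' i y * p' i\<^sub>0 y = q i x" if i: "i \<in> I" for i
  proof
    have "cmod (p i x) * (?\<alpha> * ?\<beta>) \<le> cmod (p' i y) * ?\<alpha>"
      using mult_right_mono[OF backward(1)[OF i], of ?\<alpha>] by (simp add: ac_simps)
    then have "cmod (p' i y) * cmod (q' j\<^sub>0 y) = cmod (p i x)"
      using forward(1)[OF i] \<open>w = y\<close> \<alpha>\<beta> by simp
    then show "p' i y * q' j\<^sub>0 y = p i x"
      using matched_eq[OF x(1) w(2) i0 j0 i] \<open>w = y\<close> by simp
    have "cmod (q i x) * (?\<gamma> * ?\<delta>) \<le> cmod (q' i y) * ?\<gamma>"
      using mult_right_mono[OF backward(2)[OF i], of ?\<gamma>] by (simp add: ac_simps)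
    then have "cmod (q' i y) * cmod (p' i\<^sub>0 y) = cmod (q i x)"
      using forward(2)[OF i] \<open>w = y\<close> \<gamma>\<delta> by simp
    then show "q' i y * p' i\<^sub>0 y = q i x"
      using ex.matched_eq[OF x(1) ws j0 i0 i] \<open>w = y\<close> by simp
  qed
  then show ?thesis by blast
qed

end

subsection \<open>Maximal ideal spaces\<close>

lemma continuous_map_character_apply:
  assumes "f \<in> A"
  shows "continuous_map (maximal_ideal_space A) euclidean (\<lambda>\<phi>. \<phi> f)"
  unfolding maximal_ideal_space_def
  by (intro continuous_map_from_subtopology continuous_map_product_projection assms)

lemma topspace_maximal_ideal_space: "topspace (maximal_ideal_space A) = characters A"
proof -
  have "characters A \<subseteq> PiE A (\<lambda>_. UNIV)"
    by (auto simp: characters_def PiE_def)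
  then show ?thesis by (simp add: maximal_ideal_space_def Int_absorb1)
qed

lemma character_1:
  assumes "\<phi> \<in> characters A" "(\<lambda>_. 1) \<in> A"
  shows "\<phi> (\<lambda>_. 1) = 1"
proof -
  obtain f where f: "f \<in> A" "\<phi> f \<noteq> 0" using assms(1) unfolding characters_def by blast
  have "\<forall>f\<in>A. \<forall>g\<in>A. \<phi> (\<lambda>x. f x * g x) = \<phi> f * \<phi> g"
    using assms(1) by (simp add: characters_def)
  from bspec[OF bspec[OF this f(1)] assms(2)] have "\<phi> f = \<phi> f * \<phi> (\<lambda>_. 1)" by simp
  with f(2) show ?thesis by simp
qed

lemma uniform_algebra_closed:
  assumes "uniform_algebra A"
  shows "f \<in> A \<Longrightarrow> g \<in> A \<Longrightarrow> (\<lambda>x. f x + g x) \<in> A"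
    and "f \<in> A \<Longrightarrow> g \<in> A \<Longrightarrow> (\<lambda>x. f x * g x) \<in> A"
    and "f \<in> A \<Longrightarrow> (\<lambda>x. c * f x) \<in> A"
  using assms by (simp_all add: uniform_algebra_def)

lemma algebra_isomorphism_inv:
  assumes S: "algebra_isomorphism A B S"
    and "uniform_algebra A"
  shows "algebra_isomorphism B A (inv_into A S)"
proof -
  let ?R = "inv_into A S"
  note A = uniform_algebra_closed[OF assms(2)]
  have bij: "bij_betw S A B" using S by (simp add: algebra_isomorphism_def)
  have R: "?R g \<in> A" "S (?R g) = g" if "g \<in> B" for g
    using bij that by (auto simp: bij_betw_def inv_into_into f_inv_into_f)
  have inv: "?R h = f" if "f \<in> A" "S f = h" for f h
    using bij that by (auto simp: bij_betw_def)
  show ?thesis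
    unfolding algebra_isomorphism_def
  proof (intro conjI ballI allI)
    show "bij_betw ?R B A" by (rule bij_betw_inv_into[OF bij])
    fix g h assume gh: "g \<in> B" "h \<in> B"
    show "?R (\<lambda>x. g x + h x) = (\<lambda>y. ?R g y + ?R h y)"
      by (rule inv) (use S A(1) R gh in \<open>simp_all add: algebra_isomorphism_def\<close>)
    show "?R (\<lambda>x. g x * h x) = (\<lambda>y. ?R g y * ?R h y)"
      by (rule inv) (use S A(2) R gh in \<open>simp_all add: algebra_isomorphism_def\<close>)
  next
    fix c g assume g: "g \<in> B"
    show "?R (\<lambda>x. c * g x) = (\<lambda>y. c * ?R g y)"
      by (rule inv) (use S A(3) R g in \<open>simp_all add: algebra_isomorphism_def\<close>)
  qed
qed

lemma character_comp:
  assumes S: "algebra_isomorphism A B S" and \<phi>: "\<phi> \<in> characters B"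
    and "uniform_algebra A"
  shows "restrict (\<lambda>f. \<phi> (S f)) A \<in> characters A"
proof -
  note A = uniform_algebra_closed[OF assms(3)]
  have SB: "S f \<in> B" if "f \<in> A" for f
    using S that by (auto simp: algebra_isomorphism_def bij_betw_def)
  obtain g where g: "g \<in> B" "\<phi> g \<noteq> 0" using \<phi> by (auto simp: characters_def)
  then obtain f where "f \<in> A" "S f = g"
    using S by (auto simp: algebra_isomorphism_def bij_betw_def)
  then have "\<exists>f\<in>A. restrict (\<lambda>f. \<phi> (S f)) A f \<noteq> 0" using g(2) by auto
  then show ?thesis
    using S \<phi> A SB unfolding characters_def algebra_isomorphism_def by simp
qed

lemma continuous_map_character_comp:
  assumes S: "algebra_isomorphism A B S" and A: "uniform_algebra A"
  shows "continuous_map (maximal_ideal_space B) (maximal_ideal_space A) (\<lambda>\<phi>. restrict (\<lambda>f. \<phi> (S f)) A)"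
proof -
  have "S f \<in> B" if "f \<in> A" for f
    using S that by (auto simp: algebra_isomorphism_def bij_betw_def)
  then have "continuous_map (maximal_ideal_space B) (product_topology (\<lambda>f. euclidean) A)
      (\<lambda>\<phi>. restrict (\<lambda>f. \<phi> (S f)) A)"
    by (auto simp: continuous_map_componentwise intro: continuous_map_character_apply)
  moreover have "(\<lambda>\<phi>. restrict (\<lambda>f. \<phi> (S f)) A) \<in> topspace (maximal_ideal_space B) \<rightarrow> characters A"
    using character_comp[OF S _ A] by (simp add: topspace_maximal_ideal_space)
  ultimately show ?thesis
    unfolding maximal_ideal_space_def[of A] continuous_map_in_subtopology by simp
qed

text \<open>Composition with the inverse isomorphism is the inverse map, and both are continuous
  because the topology is that of pointwise convergence.\<close>

lemma homeomorphic_map_maximal_ideal_space: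
  assumes S: "algebra_isomorphism A B S" and A: "uniform_algebra A" and B: "uniform_algebra B"
  shows "homeomorphic_map (maximal_ideal_space B) (maximal_ideal_space A) (\<lambda>\<phi>. restrict (\<lambda>f. \<phi> (S f)) A)"
proof -
  let ?R = "inv_into A S"
  have R: "algebra_isomorphism B A ?R" by (rule algebra_isomorphism_inv[OF S A])
  have bij: "bij_betw S A B" using S by (simp add: algebra_isomorphism_def)
  have RS: "?R g \<in> A" "S (?R g) = g" if "g \<in> B" for g
    using bij that by (auto simp: bij_betw_def inv_into_into f_inv_into_f)
  have SR: "S f \<in> B" "?R (S f) = f" if "f \<in> A" for f
    using bij that by (auto simp: bij_betw_def)
  have "homeomorphic_maps (maximal_ideal_space B) (maximal_ideal_space A)
      (\<lambda>\<phi>. restrict (\<lambda>f. \<phi> (S f)) A) (\<lambda>\<psi>. restrict (\<lambda>g. \<psi> (?R g)) B)"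
    unfolding homeomorphic_maps_def
  proof (intro conjI ballI)
    fix \<phi> assume "\<phi> \<in> topspace (maximal_ideal_space B)"
    \<comment> \<open>Both functionals are extensional, so agreement on \<open>B\<close> is
      enough.\<close>
    then have "\<phi> \<in> extensional B" by (simp add: topspace_maximal_ideal_space characters_def)
    then show "restrict (\<lambda>g. restrict (\<lambda>f. \<phi> (S f)) A (?R g)) B = \<phi>"
      by (intro extensionalityI[of _ B]) (auto simp: RS)
  next
    fix \<psi> assume "\<psi> \<in> topspace (maximal_ideal_space A)"
    then have "\<psi> \<in> extensional A" by (simp add: topspace_maximal_ideal_space characters_def)
    then show "restrict (\<lambda>f. restrict (\<lambda>g. \<psi> (?R g)) B (S f)) A = \<psi>"
      by (intro extensionalityI[of _ A]) (auto simp: SR)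
  qed (rule continuous_map_character_comp[OF S A] continuous_map_character_comp[OF R B])+
  then show ?thesis by (rule homeomorphic_maps_imp_map)
qed

subsection \<open>Reduction of the polynomial condition\<close>

lemma p_poly_eq: "p_poly a b f g = (\<lambda>x. (f x + b) * (g x + a))"
  by (simp add: p_poly_def fun_eq_iff algebra_simps)

context
  fixes A :: "('x::t2_space \<Rightarrow> complex) set"
    and B :: "('y::t2_space \<Rightarrow> complex) set"
    and a b :: complex
    and T :: "('x \<Rightarrow> complex) \<Rightarrow> ('y \<Rightarrow> complex)"
  assumes cA: "compact_uniform_algebra A" and cB: "compact_uniform_algebra B"
    and onto: "T ` A = B"
    and T: "\<And>f g. f \<in> A \<Longrightarrow> g \<in> A \<Longrightarrow>
           peripheral_range (p_poly a b (T f) (T g)) = peripheral_range (p_poly a b f g)"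
begin

interpretation A: compact_uniform_algebra A by (rule cA)
interpretation B: compact_uniform_algebra B by (rule cB)

text \<open>The functions of \<open>A\<close> serve as indices; surjectivity holds because adding a
  constant permutes an algebra containing the constants.\<close>

lemma peripheral_pair_shift:
  "peripheral_pair A B A (\<lambda>f x. f x + b) (\<lambda>f x. f x + a) (\<lambda>f y. T f y + b) (\<lambda>f y. T f y + a)"
proof unfold_locales
  have sA: "(\<lambda>f x. f x + c) ` A = A" for c
  proof (intro equalityI subsetI)
    fix g assume "g \<in> A"
    then show "g \<in> (\<lambda>f x. f x + c) ` A"
      by (intro image_eqI[of _ _ "\<lambda>x. g x - c"]) (auto intro: A.diff A.const)
  qed (auto intro: A.add A.const)
  have sB: "(\<lambda>f y. T f y + c) ` A = B" for c
  proof -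
    have "(\<lambda>f x. f x + c) ` B = B"
    proof (intro equalityI subsetI)
      fix g assume "g \<in> B"
      then show "g \<in> (\<lambda>f x. f x + c) ` B"
        by (intro image_eqI[of _ _ "\<lambda>x. g x - c"]) (auto intro: B.diff B.const)
    qed (auto intro: B.add B.const)
    then show ?thesis unfolding onto[symmetric] by (simp add: image_image)
  qed
  show "(\<lambda>f x. f x + b) ` A = A" "(\<lambda>f x. f x + a) ` A = A" by (rule sA)+
  show "(\<lambda>f y. T f y + b) ` A = B" "(\<lambda>f y. T f y + a) ` A = B" by (rule sB)+
qed (use T in \<open>simp add: p_poly_eq\<close>)

text \<open>The corrected map \<open>S\<close> acts at each strong boundary point of
  \<open>B\<close> as evaluation at a point of the other space. Algebraic identities therefore hold
  there, and hence everywhere.\<close>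

lemma weighted_isomorphism:
  "\<exists>u S. u \<in> B \<and> (\<forall>y. u y * u y = 1) \<and> (a \<noteq> b \<longrightarrow> u = (\<lambda>_. 1)) \<and> algebra_isomorphism A B S \<and>
     (\<forall>f\<in>A. T f = (\<lambda>y. u y * S f y + b * (u y - 1)))"
proof -
  interpret peripheral_pair A B A "\<lambda>f x. f x + b" "\<lambda>f x. f x + a" "\<lambda>f y. T f y + b" "\<lambda>f y. T f y + a"
    by (rule peripheral_pair_shift)
  have TB: "T f \<in> B" if "f \<in> A" for f using onto that by blast
  \<comment> \<open>The indices 1 - b and 1 - a are those at which f + b and f + a are the constant
    1.\<close>
  define u where "u y = T (\<lambda>_. 1 - b) y + b" for y
  define v where "v y = T (\<lambda>_. 1 - a) y + a" for y
  have uB: "u \<in> B" and vB: "v \<in> B" unfolding u_def v_def by (intro B.add TB A.const B.const)+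
  have corr: "\<exists>x. \<forall>f\<in>A. (T f y + b) * v y = f x + b \<and> (T f y + a) * u y = f x + a"
    if "y \<in> strong_boundary B" for y
    using strong_boundary_correspondence[OF that, of "\<lambda>_. 1 - b" "\<lambda>_. 1 - a"]
    by (simp add: A.const u_def v_def)
  have uv: "(\<lambda>y. u y * v y) = (\<lambda>_. 1)"
  proof (rule B.eq_if_strong_boundary)
    fix y assume "y \<in> strong_boundary B"
    then obtain x where x: "\<forall>f\<in>A. (T f y + b) * v y = f x + b" using corr by metis
    show "u y * v y = 1" using bspec[OF x A.const[of "1 - b"]] by (simp add: u_def)
  qed (intro B.mult uB vB B.const)+
  have u1: "u = (\<lambda>_. 1)" if "a \<noteq> b"
  proof (rule B.eq_if_strong_boundary)
    fix y assume "y \<in> strong_boundary B"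
    then obtain x where x: "\<forall>f\<in>A. (T f y + b) * v y = f x + b \<and> (T f y + a) * u y = f x + a"
      using corr by metis
    have "v y \<noteq> 0" using fun_cong[OF uv, of y] by auto
    \<comment> \<open>At f = -b the first relation fixes the value of T(-b) at \<open>y\<close>; the
      second then reads (a - b) u(y) = a - b.\<close>
    moreover have 0: "(T (\<lambda>_. - b) y + b) * v y = 0" "(T (\<lambda>_. - b) y + a) * u y = a - b"
      using bspec[OF x A.const[of "- b"]] by simp_all
    ultimately have "T (\<lambda>_. - b) y = - b" by (simp add: eq_neg_iff_add_eq_0)
    then have "(a - b) * u y = a - b" using 0(2) by simp
    then show "u y = 1" using that by simp
  qed (intro uB B.const)+
  have u_eq_v: "u = v"
  proof (cases "a = b")
    case False
    then show ?thesis using uv u1 by simp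
  qed (simp add: u_def v_def fun_eq_iff)
  have uu: "u y * u y = 1" for y using uv u_eq_v by metis
  define S where "S f y = u y * (T f y + b) - b" for f y
  have SB: "S f \<in> B" if "f \<in> A" for f
    unfolding S_def using that by (intro B.diff B.mult B.add uB TB B.const)
  have S: "\<exists>x. \<forall>f\<in>A. S f y = f x" if "y \<in> strong_boundary B" for y
  proof -
    from corr[OF that] obtain x where "\<forall>f\<in>A. (T f y + b) * v y = f x + b" by metis
    then show ?thesis unfolding S_def using u_eq_v by (intro exI[of _ x]) (simp add: mult.commute)
  qed
  have T_S: "T f y = u y * S f y + b * (u y - 1)" for f y
  proof -
    have "u y * S f y + b * (u y - 1) = (u y * u y) * (T f y + b) - b"
      by (simp add: S_def algebra_simps)
    then show ?thesis by (simp add: uu)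
  qed
  have S_add: "S (\<lambda>x. f x + g x) = (\<lambda>y. S f y + S g y)" if "f \<in> A" "g \<in> A" for f g
  proof (rule B.eq_if_strong_boundary)
    fix y assume "y \<in> strong_boundary B"
    then obtain x where "\<forall>f\<in>A. S f y = f x" using S by metis
    then show "S (\<lambda>x. f x + g x) y = S f y + S g y" using that by (simp add: A.add)
  qed (intro SB A.add B.add that)+
  have S_mult: "S (\<lambda>x. f x * g x) = (\<lambda>y. S f y * S g y)" if "f \<in> A" "g \<in> A" for f g
  proof (rule B.eq_if_strong_boundary)
    fix y assume "y \<in> strong_boundary B"
    then obtain x where "\<forall>f\<in>A. S f y = f x" using S by metis
    then show "S (\<lambda>x. f x * g x) y = S f y * S g y" using that by (simp add: A.mult)
  qed (intro SB A.mult B.mult that)+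
  have S_scale: "S (\<lambda>x. c * f x) = (\<lambda>y. c * S f y)" if "f \<in> A" for c f
  proof (rule B.eq_if_strong_boundary)
    fix y assume "y \<in> strong_boundary B"
    then obtain x where "\<forall>f\<in>A. S f y = f x" using S by metis
    then show "S (\<lambda>x. c * f x) y = c * S f y" using that by (simp add: A.scale)
  qed (intro SB A.scale B.scale that)+
  have "inj_on S A"
  proof (rule inj_onI)
    fix f g assume fg: "f \<in> A" "g \<in> A" "S f = S g"
    \<comment> \<open>The shift by \<open>b\<close> is chosen so that S h = -b, that is, T h + b =
      0. Pairing with the index 1 - a, where the second factor is 1, transfers this to h + b =
      0.\<close>
    define h where "h x = f x - g x - b" for x
    have h: "h \<in> A" unfolding h_def by (intro A.diff A.const fg)
    have f_eq: "f = (\<lambda>x. h x + (g x + b))" by (simp add: h_def)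
    have "S f = (\<lambda>y. S h y + (S g y + S (\<lambda>_. b) y))"
      by (subst f_eq) (simp add: S_add h fg A.add A.const)
    then have "S h y = - S (\<lambda>_. b) y" for y using fg(3) by (simp add: fun_eq_iff) (metis add_cancel_right_right add.commute add.left_commute eq_neg_iff_add_eq_0)
    moreover have "S (\<lambda>_. b) = (\<lambda>_. b)"
    proof (rule B.eq_if_strong_boundary)
      fix y assume "y \<in> strong_boundary B"
      then obtain x where "\<forall>f\<in>A. S f y = f x" using S by metis
      then show "S (\<lambda>_. b) y = b" by (simp add: A.const)
    qed (intro SB A.const B.const)+
    ultimately have "T h y + b = 0" for y using T_S[of h y] by (simp add: algebra_simps)
    then have "sup_norm (\<lambda>x. h x + b) = 0"
      using sup_norm_eq[OF h A.const[of "1 - a"]] by (simp add: sup_norm_def)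
    then have "h x + b = 0" for x
      using A.norm_le_sup_norm[OF A.add[OF h A.const[of b]], of x] by simp
    then show "f = g" by (simp add: h_def fun_eq_iff)
  qed
  moreover have "S ` A = B"
  proof (intro equalityI subsetI)
    fix g assume "g \<in> B"
    \<comment> \<open>Since u^2 = 1, the correction that defines \<open>S\<close> is its own
      inverse.\<close>
    then have "(\<lambda>y. u y * (g y + b) - b) \<in> B" by (intro B.diff B.mult B.add uB B.const)
    then obtain f where f: "f \<in> A" "T f = (\<lambda>y. u y * (g y + b) - b)" using onto by (metis (no_types, lifting) imageE)
    have "S f y = (u y * u y) * (g y + b) - b" for y by (simp add: S_def f(2) algebra_simps)
    then have "S f = g" by (simp add: uu fun_eq_iff)
    then show "g \<in> S ` A" using f(1) by blast
  qed (use SB in blast)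
  ultimately have "algebra_isomorphism A B S"
    using S_add S_mult S_scale by (simp add: algebra_isomorphism_def bij_betw_def)
  moreover have "\<forall>f\<in>A. T f = (\<lambda>y. u y * S f y + b * (u y - 1))" using T_S by blast
  ultimately show ?thesis using uB uu u1 by blast
qed

end

section \<open>Passage to the Gelfand transforms\<close>

theorem theorem5p1:
  fixes A :: "('x::t2_space \<Rightarrow> complex) set"
    and B :: "('y::t2_space \<Rightarrow> complex) set"
    and a b :: complex
    and T :: "('x \<Rightarrow> complex) \<Rightarrow> ('y \<Rightarrow> complex)"
  assumes "compact (UNIV :: 'x set)"
    and "compact (UNIV :: 'y set)"
    and "uniform_algebra A"
    and "uniform_algebra B"
    and "T ` A = B"
    and "\<And>f g. f \<in> A \<Longrightarrow> g \<in> A \<Longrightarrow>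
           peripheral_range (p_poly a b (T f) (T g)) = peripheral_range (p_poly a b f g)"
  shows "(a \<noteq> b \<longrightarrow>
           algebra_isomorphism A B T \<and>
           (\<exists>\<Phi>. homeomorphic_map (maximal_ideal_space B) (maximal_ideal_space A) \<Phi> \<and>
             (\<forall>f\<in>A. \<forall>y\<in>topspace (maximal_ideal_space B).
               gelfand (T f) y = gelfand f (\<Phi> y))))
       \<and> (a = b \<longrightarrow>
           (\<exists>\<eta> \<Phi>. continuous_map (maximal_ideal_space B) (top_of_set {-1, 1 :: complex}) \<eta> \<and>
             homeomorphic_map (maximal_ideal_space B) (maximal_ideal_space A) \<Phi> \<and>
             (\<forall>f\<in>A. \<forall>y\<in>topspace (maximal_ideal_space B).
               gelfand (T f) y = \<eta> y * gelfand f (\<Phi> y) + a * (\<eta> y - 1))))"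
proof -
  interpret A: compact_uniform_algebra A by unfold_locales (fact assms)+
  interpret B: compact_uniform_algebra B by unfold_locales (fact assms)+
  have "\<exists>u S. u \<in> B \<and> (\<forall>y. u y * u y = 1) \<and> (a \<noteq> b \<longrightarrow> u = (\<lambda>_. 1)) \<and>
      algebra_isomorphism A B S \<and> (\<forall>f\<in>A. T f = (\<lambda>y. u y * S f y + b * (u y - 1)))"
    by (intro weighted_isomorphism assms A.compact_uniform_algebra_axioms B.compact_uniform_algebra_axioms)
  then obtain u S where "u \<in> B \<and> (\<forall>y. u y * u y = 1) \<and> (a \<noteq> b \<longrightarrow> u = (\<lambda>_. 1)) \<and>
      algebra_isomorphism A B S \<and> (\<forall>f\<in>A. T f = (\<lambda>y. u y * S f y + b * (u y - 1)))"
    by (elim exE)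
  then have u: "u \<in> B" "\<And>y. u y * u y = 1" "a \<noteq> b \<Longrightarrow> u = (\<lambda>_. 1)"
    and S: "algebra_isomorphism A B S"
    and T: "\<And>f. f \<in> A \<Longrightarrow> T f = (\<lambda>y. u y * S f y + b * (u y - 1))"
    by simp_all
  define \<Phi> where "\<Phi> \<phi> = restrict (\<lambda>f. \<phi> (S f)) A" for \<phi> :: "('y \<Rightarrow> complex) \<Rightarrow> complex"
  have \<Phi>: "homeomorphic_map (maximal_ideal_space B) (maximal_ideal_space A) \<Phi>"
    unfolding \<Phi>_def by (rule homeomorphic_map_maximal_ideal_space[OF S assms(3,4)])
  have SB: "S f \<in> B" if "f \<in> A" for f
    using S that by (auto simp: algebra_isomorphism_def bij_betw_def)
  \<comment> \<open>A character fixes constants, so applying it to the weighted formula gives the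
    formula on the maximal ideal space; u^2 = 1 makes its value at \<open>u\<close> a sign.\<close>
  have char: "\<phi> (T f) = \<phi> u * \<Phi> \<phi> f + b * (\<phi> u - 1)" "\<phi> u * \<phi> u = 1" if f: "f \<in> A" and \<phi>: "\<phi> \<in> characters B" for \<phi> f
  proof -
    have \<phi>_add: "\<phi> (\<lambda>x. g x + h x) = \<phi> g + \<phi> h" and \<phi>_mult: "\<phi> (\<lambda>x. g x * h x) = \<phi> g * \<phi> h"
      if "g \<in> B" "h \<in> B" for g h
      using \<phi> that by (auto simp: characters_def)
    note \<phi>1 = character_1[OF \<phi> B.const]
    have "\<forall>c. \<forall>g\<in>B. \<phi> (\<lambda>x. c * g x) = c * \<phi> g" using \<phi> by (simp add: characters_def)
    from bspec[OF spec[OF this] B.const[of 1]] have \<phi>_const: "\<phi> (\<lambda>_. c) = c" for c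
      by (simp add: \<phi>1)
    have "\<phi> (\<lambda>y. u y * S f y + b * (u y + - 1)) = \<phi> u * \<phi> (S f) + b * (\<phi> u + - 1)"
      by (simp only: \<phi>_add \<phi>_mult \<phi>_const u(1) SB[OF f] B.mult B.add B.const)
    then show "\<phi> (T f) = \<phi> u * \<Phi> \<phi> f + b * (\<phi> u - 1)" using f by (simp add: T \<Phi>_def)
    show "\<phi> u * \<phi> u = 1" using \<phi>_mult[OF u(1) u(1)] by (simp add: u(2) \<phi>1)
  qed
  show ?thesis
  proof (intro conjI impI)
    assume "a \<noteq> b"
    then have u1: "u = (\<lambda>_. 1)" by (rule u(3))
    then have TS: "T f = S f" if "f \<in> A" for f using T[OF that] by simp
    have "bij_betw T A B \<longleftrightarrow> bij_betw S A B" by (rule bij_betw_cong) (rule TS)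
    then show "algebra_isomorphism A B T"
      using S by (simp add: algebra_isomorphism_def TS A.add A.mult A.scale)
    have "\<forall>f\<in>A. \<forall>y\<in>topspace (maximal_ideal_space B). gelfand (T f) y = gelfand f (\<Phi> y)"
      by (simp add: gelfand_def \<Phi>_def TS)
    with \<Phi> show "\<exists>\<Phi>. homeomorphic_map (maximal_ideal_space B) (maximal_ideal_space A) \<Phi> \<and>
       (\<forall>f\<in>A. \<forall>y\<in>topspace (maximal_ideal_space B). gelfand (T f) y = gelfand f (\<Phi> y))" by blast
  next
    assume "a = b"
    \<comment> \<open>The required sign function is the Gelfand transform of
      \<open>u\<close>.\<close>
    have "continuous_map (maximal_ideal_space B) (top_of_set {-1, 1 :: complex}) (\<lambda>\<phi>. \<phi> u)"
      unfolding continuous_map_in_subtopology topspace_maximal_ideal_space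
      using continuous_map_character_apply[OF u(1)] char(2)[OF A.const]
      by (auto simp: square_eq_1_iff)
    moreover have "\<forall>f\<in>A. \<forall>y\<in>topspace (maximal_ideal_space B).
       gelfand (T f) y = y u * gelfand f (\<Phi> y) + a * (y u - 1)"
      unfolding topspace_maximal_ideal_space gelfand_def using char(1) \<open>a = b\<close> by simp
    ultimately show "\<exists>\<eta> \<Phi>. continuous_map (maximal_ideal_space B) (top_of_set {-1, 1 :: complex}) \<eta> \<and>
        homeomorphic_map (maximal_ideal_space B) (maximal_ideal_space A) \<Phi> \<and>
        (\<forall>f\<in>A. \<forall>y\<in>topspace (maximal_ideal_space B).
          gelfand (T f) y = \<eta> y * gelfand f (\<Phi> y) + a * (\<eta> y - 1))"
      using \<Phi> by blast
  qed
qed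

end
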